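(* Let $T$ be a locally finite tree and let $\Gamma$ be a cocompact lattice in $\mathrm{Aut}(T)$. For $n\ge 1$ let $u_\Gamma(n)$ denote the number of subgroups $\Gamma'$ with $\Gamma\subset\Gamma'\subset \mathrm{Aut}(T)$ and $[\Gamma':\Gamma]=n$. Then there are positive constants $C_0$ and $C_1$, depending on $\Gamma$, such that $$\forall n\ge 1,\qquad u_\Gamma(n)\le C_0\, n^{C_1\log^2(n)}.$$
   Context: A tree is locally finite if every vertex has finite valence. Automorphisms are considered without inversions: all subgroups of $\mathrm{Aut}(T)$ under consideration ($\Gamma$ and the overgroups $\Gamma'$) act on $T$ without inversions, i.e. no element maps an oriented edge to its reverse. A subgroup $\Gamma\le\mathrm{Aut}(T)$ is discrete if the stabilizer $\Gamma_x$ is finite for some (equivalently every) vertex $x$ of $T$. Its covolume is $\sum_{x\in\Gamma\backslash VT}1/|\Gamma_x|$. A discrete subgroup is a lattice if its covolume is finite, and a lattice is cocompact if the quotient graph $\Gamma\backslash T$ is finite. An overlattice of $\Gamma$ of index $n$ is a lattice of $\mathrm{Aut}(T)$ containing $\Gamma$ with index $n$. For a cocompact lattice $\Gamma$ the number $u_\Gamma(n)$ is known to be finite. $\log^2(n)$ means $(\log n)^2$. *)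

theory Defs
  imports
    "HOL-Analysis.Infinite_Sum"
    "HOL-Algebra.Group_Action"
    "Graph_Theory.Digraph_Component"
begin

text \<open>
  A simplicial graph is a symmetric loop-free digraph whose arcs are pairs of vertices; the arcs
  are the oriented edges. In a symmetric digraph every edge gives the closed walk a, b, a, which
  \<^const>\<open>pre_digraph.cycle\<close> counts as a cycle, so the predicate
  \<^const>\<open>Digraph_Component.tree\<close> is unsuitable here. A circuit is a cycle of length at least 3.
\<close>

locale locally_finite_tree = pair_bidirected_digraph T
  for T :: "'a pair_pre_digraph" +
  assumes tree_connected: "strongly_connected (with_proj T)"
    and no_circuit: "\<not> (\<exists>p. pre_digraph.cycle (with_proj T) p \<and> 3 \<le> length p)"
    and finite_valence: "\<And>v. v \<in> pverts T \<Longrightarrow> finite {w. (v, w) \<in> parcs T}"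

text \<open>
  A simplicial graph has no parallel edges, so its automorphisms are determined by their action
  on the vertices. They are extensional (\<^term>\<open>undefined\<close> outside the vertex set), as in
  \<^const>\<open>BijGroup\<close>, so that distinct functions are distinct automorphisms.
\<close>

definition Aut :: "'a pair_pre_digraph \<Rightarrow> ('a \<Rightarrow> 'a) monoid" where
  "Aut T = BijGroup (pverts T)
     \<lparr>carrier := {f \<in> Bij (pverts T).
        \<forall>u\<in>pverts T. \<forall>v\<in>pverts T. (f u, f v) \<in> parcs T \<longleftrightarrow> (u, v) \<in> parcs T}\<rparr>"

lemma group_Aut: "group (Aut T)"
proof -
  let ?V = "pverts T"
  let ?A = "{f \<in> Bij ?V. \<forall>u\<in>?V. \<forall>v\<in>?V. (f u, f v) \<in> parcs T \<longleftrightarrow> (u, v) \<in> parcs T}"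
  interpret B: group "BijGroup ?V"
    by (rule group_BijGroup)
  have "subgroup ?A (BijGroup ?V)"
  proof (rule B.subgroupI)
    show "?A \<subseteq> carrier (BijGroup ?V)"
      by (auto simp: BijGroup_def)
    have "(\<lambda>x\<in>?V. x) \<in> ?A"
      by (auto simp: id_Bij)
    then show "?A \<noteq> {}"
      by blast
  next
    fix f assume f: "f \<in> ?A"
    then have inv: "f (inv_into ?V f x) = x" "inv_into ?V f x \<in> ?V" if "x \<in> ?V" for x
      using that by (auto simp: Bij_def bij_betw_def f_inv_into_f inv_into_into)
    have "(inv_into ?V f u, inv_into ?V f v) \<in> parcs T \<longleftrightarrow> (u, v) \<in> parcs T"
      if "u \<in> ?V" "v \<in> ?V" for u v
      using f inv[OF that(1)] inv[OF that(2)] by fastforce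
    with f show "inv\<^bsub>BijGroup ?V\<^esub> f \<in> ?A"
      by (simp add: inv_BijGroup restrict_inv_into_Bij)
  next
    fix f g assume fg: "f \<in> ?A" "g \<in> ?A"
    then have "g x \<in> ?V" if "x \<in> ?V" for x
      using that Bij_imp_funcset by blast
    with fg show "f \<otimes>\<^bsub>BijGroup ?V\<^esub> g \<in> ?A"
      by (simp add: BijGroup_def compose_Bij) (simp add: compose_def)
  qed
  then show ?thesis
    unfolding Aut_def by (rule B.subgroup_imp_group)
qed

definition without_inversions :: "'a pair_pre_digraph \<Rightarrow> ('a \<Rightarrow> 'a) set \<Rightarrow> bool" where
  "without_inversions T \<Gamma> \<longleftrightarrow> (\<forall>g\<in>\<Gamma>. \<forall>(u, v)\<in>parcs T. (g u, g v) \<noteq> (v, u))"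

abbreviation vertex_stabilizer ::
    "'a pair_pre_digraph \<Rightarrow> ('a \<Rightarrow> 'a) set \<Rightarrow> 'a \<Rightarrow> ('a \<Rightarrow> 'a) set" where
  "vertex_stabilizer T \<Gamma> x \<equiv> Group_Action.stabilizer (Aut T\<lparr>carrier := \<Gamma>\<rparr>) (\<lambda>g. g) x"

definition discrete_subgroup :: "'a pair_pre_digraph \<Rightarrow> ('a \<Rightarrow> 'a) set \<Rightarrow> bool" where
  "discrete_subgroup T \<Gamma> \<longleftrightarrow> subgroup \<Gamma> (Aut T) \<and> without_inversions T \<Gamma> \<and>
     (\<exists>x\<in>pverts T. finite (vertex_stabilizer T \<Gamma> x))"

text \<open>
  The quotient graph has the orbits of vertices as vertices and the orbits of oriented edges as
  arcs; it may have loops and parallel arcs.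
\<close>

definition quotient_graph ::
    "'a pair_pre_digraph \<Rightarrow> ('a \<Rightarrow> 'a) set \<Rightarrow> ('a set, ('a \<times> 'a) set) pre_digraph" where
  "quotient_graph T \<Gamma> =
     \<lparr>verts = Group_Action.orbits (Aut T\<lparr>carrier := \<Gamma>\<rparr>) (pverts T) (\<lambda>g. g),
      arcs = Group_Action.orbits (Aut T\<lparr>carrier := \<Gamma>\<rparr>) (parcs T) (\<lambda>g. map_prod g g),
      tail = (`) fst,
      head = (`) snd\<rparr>"

text \<open>
  Vertices in the same orbit have conjugate stabilizers, so the choice of a representative of an
  orbit is immaterial. The definition is meaningful for discrete \<open>\<Gamma>\<close>, all of whose vertex
  stabilizers are finite.
\<close>

definition covolume :: "'a pair_pre_digraph \<Rightarrow> ('a \<Rightarrow> 'a) set \<Rightarrow> ennreal" where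
  "covolume T \<Gamma> = (\<Sum>\<^sub>\<infinity>X\<in>verts (quotient_graph T \<Gamma>).
     1 / of_nat (card (vertex_stabilizer T \<Gamma> (SOME x. x \<in> X))))"

definition lattice_subgroup :: "'a pair_pre_digraph \<Rightarrow> ('a \<Rightarrow> 'a) set \<Rightarrow> bool" where
  "lattice_subgroup T \<Gamma> \<longleftrightarrow> discrete_subgroup T \<Gamma> \<and> covolume T \<Gamma> < \<infinity>"

definition cocompact_lattice :: "'a pair_pre_digraph \<Rightarrow> ('a \<Rightarrow> 'a) set \<Rightarrow> bool" where
  "cocompact_lattice T \<Gamma> \<longleftrightarrow> lattice_subgroup T \<Gamma> \<and>
     finite (verts (quotient_graph T \<Gamma>)) \<and> finite (arcs (quotient_graph T \<Gamma>))"

text \<open>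
  An infinite coset space has cardinality 0, so for \<open>n \<ge> 1\<close> the last condition says that the
  index is finite and equal to \<open>n\<close>.
\<close>

definition overgroups ::
    "'a pair_pre_digraph \<Rightarrow> ('a \<Rightarrow> 'a) set \<Rightarrow> nat \<Rightarrow> ('a \<Rightarrow> 'a) set set" where
  "overgroups T \<Gamma> n = {\<Gamma>'. subgroup \<Gamma>' (Aut T) \<and> without_inversions T \<Gamma>' \<and> \<Gamma> \<subseteq> \<Gamma>' \<and>
     card (rcosets\<^bsub>Aut T\<lparr>carrier := \<Gamma>'\<rparr>\<^esub> \<Gamma>) = n}"

end

theory Submission
  imports Defs "HOL-Library.Sublist" "HOL-Algebra.Divisibility"
begin

text \<open>
  Choose a finite set \<open>F\<close> of representatives of the orbits of \<open>\<Gamma>\<close> on the vertices and, for every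
  vertex \<open>z\<close>, some \<open>\<gamma> z \<in> \<Gamma>\<close> moving a point \<open>\<rho> z \<in> F\<close> to \<open>z\<close>. Let \<open>H\<close> be an overgroup of index \<open>n\<close>.
  An element \<open>g \<in> H\<close> with \<open>g x = y\<close>, where \<open>x, y \<in> F\<close>, maps a neighbour \<open>z\<close> of \<open>x\<close> to a neighbour \<open>w\<close>
  of \<open>y\<close>, and its section \<open>(\<gamma> w)\<^sup>-\<^sup>1 g \<gamma> z\<close> again moves a point of \<open>F\<close> to a point of \<open>F\<close>. So, as for
  self-similar groups, \<open>H\<close> is determined once for finitely many generators the images of the
  neighbours are known and the sections are written as words in the generators: this recursion
  computes the generators on larger and larger balls.

  The stabilizers in \<open>H\<close> of the points of \<open>F\<close> have order \<open>O(n)\<close>. A group of order at most \<open>2\<^sup>t\<close>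
  has a sequence of \<open>2 t\<close> elements such that every element is the product of a subsequence. Hence
  \<open>O(log n)\<close> generators suffice, every section has one of \<open>n\<^bsup>O(1)\<^esup>\<close> words, and there are at most
  \<open>n\<^bsup>O(log n)\<^esup>\<close> overgroups. The argument uses only that the graph is connected and locally finite.
\<close>

section \<open>Short product systems of finite groups\<close>

lemma (in monoid) foldr_mult_append:
  assumes "set xs \<subseteq> carrier G" "set ys \<subseteq> carrier G"
  shows "foldr (\<otimes>) (xs @ ys) \<one> = foldr (\<otimes>) xs \<one> \<otimes> foldr (\<otimes>) ys \<one>"
  using assms by (induction xs) (auto simp: m_assoc)

lemma (in group) inv_foldr_mult:
  assumes "set xs \<subseteq> carrier G"
  shows "inv (foldr (\<otimes>) xs \<one>) = foldr (\<otimes>) (rev (map (m_inv G) xs)) \<one>"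
  using assms
proof (induction xs)
  case (Cons x xs)
  then have "foldr (\<otimes>) (rev (map (m_inv G) xs) @ [inv x]) \<one> =
      foldr (\<otimes>) (rev (map (m_inv G) xs)) \<one> \<otimes> foldr (\<otimes>) [inv x] \<one>"
    by (intro foldr_mult_append) auto
  with Cons show ?case
    by (auto simp: inv_mult_group)
qed simp

lemma subseq_rev:
  assumes "subseq xs ys"
  shows "subseq (rev xs) (rev ys)"
  using assms
proof induction
  case (list_emb_Cons2 x y xs ys)
  then have "subseq (rev xs @ [x]) (rev ys @ [y])"
    by (intro list_emb_append_mono) auto
  then show ?case
    by simp
qed auto

lemma subseq_set_subset: "subseq xs ys \<Longrightarrow> set xs \<subseteq> set ys"
  by (metis set_nths_subset subseq_conv_nths)

lemma subseq_mapE: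
  assumes "subseq xs (map f ys)"
  obtains zs where "subseq zs ys" "xs = map f zs"
  using assms by (metis nths_map subseq_conv_nths)

text \<open>
  A longest sequence whose \<open>2 ^ length hs\<close> subsequences have pairwise distinct products cannot be
  extended by any \<open>g\<close>, so the set \<open>C\<close> of these products meets \<open>g C\<close>, that is, \<open>g \<in> C C\<^sup>-\<^sup>1\<close>.
\<close>

lemma (in group) short_product_system:
  assumes fin: "finite (carrier G)" and order: "order G \<le> 2 ^ t"
  obtains hs where "length hs = 2 * t" "set hs \<subseteq> carrier G"
    "\<And>g. g \<in> carrier G \<Longrightarrow> \<exists>ws. subseq ws hs \<and> g = foldr (\<otimes>) ws \<one>"
proof -
  define C where "C hs = (\<lambda>ws. foldr (\<otimes>) ws \<one>) ` {ws. subseq ws hs}" for hs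
  define P where "P hs \<longleftrightarrow> set hs \<subseteq> carrier G \<and> card (C hs) = 2 ^ length hs" for hs
  have subseq_carrier: "set ws \<subseteq> carrier G" if "subseq ws hs" "set hs \<subseteq> carrier G" for ws hs
    using subseq_set_subset[OF that(1)] that(2) by blast
  have C_carrier: "C hs \<subseteq> carrier G" if "set hs \<subseteq> carrier G" for hs
    using subseq_carrier[OF _ that] multlist_closed unfolding C_def by blast
  have C_Cons: "C (h # hs) = C hs \<union> (\<otimes>) h ` C hs" for h hs
  proof -
    have "ws \<in> {ws. subseq ws (h # hs)} \<longleftrightarrow> ws \<in> {ws. subseq ws hs} \<union> (#) h ` {ws. subseq ws hs}" for ws
      by (cases ws) (auto dest: subseq_Cons' split: if_splits)
    then have "{ws. subseq ws (h # hs)} = {ws. subseq ws hs} \<union> (#) h ` {ws. subseq ws hs}"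
      by blast
    then show ?thesis
      by (simp add: C_def image_Un image_image)
  qed
  have "P []"
  proof -
    have *: "{ws. subseq ws []} = {[]}"
      by auto
    have "C [] = {\<one>}"
      unfolding C_def * by simp
    then show ?thesis
      by (simp add: P_def)
  qed
  \<comment> \<open>Pairwise distinct products fill \<open>2 ^ length hs\<close> places in a group
    of order at most \<open>2 ^ t\<close>; this bound makes a longest such sequence exist.\<close>
  moreover have bound: "length hs \<le> t" if "P hs" for hs
  proof -
    have "2 ^ length hs \<le> order G"
      using that C_carrier[of hs] card_mono[OF fin] unfolding P_def order_def by metis
    then have "(2::nat) ^ length hs \<le> 2 ^ t"
      using order by linarith
    then show ?thesis
      by simp
  qed
  ultimately obtain hs where hs: "P hs" and max: "\<And>hs'. P hs' \<Longrightarrow> length hs' \<le> length hs"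
    using ex_has_greatest_nat[of P "[]" length "Suc t"] by (metis less_Suc_eq_le)
  have hs_carrier: "set hs \<subseteq> carrier G"
    using hs by (simp add: P_def)
  have finC: "finite (C hs)"
    using C_carrier[OF hs_carrier] fin finite_subset by blast
  have quotients: "\<exists>a\<in>C hs. \<exists>b\<in>C hs. g = a \<otimes> inv b" if g: "g \<in> carrier G" for g
  proof -
    have "\<not> P (g # hs)"
      using max[of "g # hs"] by auto
    then have "card (C (g # hs)) \<noteq> 2 * card (C hs)"
      using hs g by (auto simp: P_def)
    moreover have "card ((\<otimes>) g ` C hs) = card (C hs)"
      using C_carrier[OF hs_carrier] g
      by (intro card_image inj_on_subset[OF inj_on_cmult])
    ultimately have "C hs \<inter> (\<otimes>) g ` C hs \<noteq> {}"
      using card_Un_disjoint[of "C hs" "(\<otimes>) g ` C hs"] finC by (auto simp: C_Cons)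
    then obtain a b where "a \<in> C hs" "b \<in> C hs" "a = g \<otimes> b"
      by blast
    moreover from this have "g = a \<otimes> inv b"
      using C_carrier[OF hs_carrier] g by (auto simp: m_assoc)
    ultimately show ?thesis
      by blast
  qed
  \<comment> \<open>The inverse of a product is the reversed product of the inverses, so a
    subsequence of the middle block evaluates to an arbitrary element of the inverse of
    \<open>C hs\<close>. The padding by units makes the length depend on \<open>t\<close>
    alone.\<close>
  define ks where "ks = hs @ rev (map (m_inv G) hs) @ replicate (2 * t - 2 * length hs) \<one>"
  show ?thesis
  proof (rule that[of ks])
    show "length ks = 2 * t"
      using bound[OF hs] by (simp add: ks_def)
    show "set ks \<subseteq> carrier G"
      using hs_carrier by (auto simp: ks_def)
    fix g assume "g \<in> carrier G"
    from quotients[OF this] obtain us vs where uv: "subseq us hs" "subseq vs hs"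
      "g = foldr (\<otimes>) us \<one> \<otimes> inv (foldr (\<otimes>) vs \<one>)"
      unfolding C_def by blast
    then have carr: "set us \<subseteq> carrier G" "set vs \<subseteq> carrier G"
      using subseq_carrier hs_carrier by blast+
    have "g = foldr (\<otimes>) (us @ rev (map (m_inv G) vs)) \<one>"
      using uv carr by (subst foldr_mult_append) (auto simp: inv_foldr_mult)
    moreover have "subseq (us @ rev (map (m_inv G) vs)) ks"
    proof -
      have "subseq (rev (map (m_inv G) vs)) (rev (map (m_inv G) hs))"
        unfolding rev_map using uv(2) by (intro subseq_map subseq_rev)
      then show ?thesis
        using uv(1) unfolding ks_def by (intro list_emb_append_mono subseq_rev_drop_many)
    qed
    ultimately show "\<exists>ws. subseq ws ks \<and> g = foldr (\<otimes>) ws \<one>"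
      by blast
  qed
qed

lemma (in group) card_le_index_times_card_Int:
  assumes H: "subgroup H G" and K: "subgroup K G"
    and fin: "finite (rcosets K)" "finite (H \<inter> K)"
  shows "finite H \<and> card H \<le> card (rcosets K) * card (H \<inter> K)"
proof -
  interpret H: subgroup H G by fact
  interpret K: subgroup K G by fact
  define r where "r D = (SOME h. h \<in> H \<inter> D)" for D
  have "h \<in> (\<lambda>(D, k). k \<otimes> r D) ` ((rcosets K) \<times> (H \<inter> K))" if h: "h \<in> H" for h
  proof -
    have hD: "h \<in> H \<inter> (K #> h)"
      using h rcos_self[OF _ K] by auto
    then have r: "r (K #> h) \<in> H" "r (K #> h) \<in> K #> h"
      unfolding r_def by (metis IntE someI)+
    then obtain k where k: "k \<in> K" "r (K #> h) = k \<otimes> h"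
      by (auto simp: r_coset_def)
    then have "h \<otimes> inv (r (K #> h)) = inv k"
      using h r by (simp add: inv_mult_group H.mem_carrier flip: m_assoc)
    then have "h \<otimes> inv (r (K #> h)) \<in> H \<inter> K"
      using h r k by (metis IntI H.m_closed H.m_inv_closed K.m_inv_closed)
    moreover have "h = h \<otimes> inv (r (K #> h)) \<otimes> r (K #> h)"
      using h r by (simp add: m_assoc H.mem_carrier)
    moreover have "K #> h \<in> rcosets K"
      using h by (auto simp: RCOSETS_def)
    ultimately show ?thesis
      by (intro image_eqI[of _ _ "(K #> h, h \<otimes> inv (r (K #> h)))"]) auto
  qed
  then have sub: "H \<subseteq> (\<lambda>(D, k). k \<otimes> r D) ` ((rcosets K) \<times> (H \<inter> K))"
    by blast
  have fin': "finite ((rcosets K) \<times> (H \<inter> K))"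
    using fin by blast
  have "card H \<le> card ((rcosets K) \<times> (H \<inter> K))"
    using surj_card_le[OF fin' sub] .
  then show ?thesis
    using finite_surj[OF fin' sub] by (simp add: card_cartesian_product)
qed


section \<open>Recursive presentations of groups acting on a graph\<close>

text \<open>The relation \<open>R\<close> is adjacency or equality, so \<open>R ^^ k\<close> is the relation of distance at most \<open>k\<close>.\<close>

locale graph_action = faithful_action G E \<phi> + group G
  for G (structure) and E and \<phi> +
  fixes R
  assumes adjacent_carrier: "R \<subseteq> E \<times> E"
    and adjacent_refl: "\<And>x. x \<in> E \<Longrightarrow> (x, x) \<in> R"
    and adjacent_connected: "\<And>x y. x \<in> E \<Longrightarrow> y \<in> E \<Longrightarrow> (x, y) \<in> R\<^sup>*"
    and adjacent_invariant: "\<And>g x y. g \<in> carrier G \<Longrightarrow> (x, y) \<in> R \<Longrightarrow> (\<phi> g x, \<phi> g y) \<in> R"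
begin

lemma act_closed: "g \<in> carrier G \<Longrightarrow> x \<in> E \<Longrightarrow> \<phi> g x \<in> E"
  using element_image by blast

lemma act_mult: "g \<in> carrier G \<Longrightarrow> h \<in> carrier G \<Longrightarrow> x \<in> E \<Longrightarrow> \<phi> (g \<otimes> h) x = \<phi> g (\<phi> h x)"
  by (simp add: composition_rule)

lemma act_one: "x \<in> E \<Longrightarrow> \<phi> \<one> x = x"
  by (metis id_eq_one restrict_apply')

lemma act_inv: "g \<in> carrier G \<Longrightarrow> x \<in> E \<Longrightarrow> \<phi> (inv g) (\<phi> g x) = x"
  using orbit_sym_aux by blast

lemma act_inv': "g \<in> carrier G \<Longrightarrow> x \<in> E \<Longrightarrow> \<phi> g (\<phi> (inv g) x) = x"
  using act_inv[of "inv g"] by simp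

lemma act_eqI:
  assumes "g \<in> carrier G" "h \<in> carrier G" "\<And>x. x \<in> E \<Longrightarrow> \<phi> g x = \<phi> h x"
  shows "g = h"
proof -
  have "\<phi> g = \<phi> h"
    using bij_prop0 assms by (intro extensionalityI[of _ E]) (auto simp: Bij_def)
  then show ?thesis
    using faithful assms by (auto simp: inj_on_def)
qed

lemma relpow_invariant:
  assumes "g \<in> carrier G" "(x, y) \<in> R ^^ k"
  shows "(\<phi> g x, \<phi> g y) \<in> R ^^ k"
  using assms(2) by (induction k arbitrary: y) (auto intro: adjacent_invariant[OF assms(1)])

lemma relpow_carrier: "x \<in> E \<Longrightarrow> (x, y) \<in> R ^^ k \<Longrightarrow> y \<in> E"
  using adjacent_carrier by (cases k) auto

text \<open>For a subgroup \<open>H\<close>, a nonempty transporter is a left coset of the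
  stabilizer \<open>transporter H x x\<close>. One arrow from \<open>x\<close> to \<open>y\<close>
  and the generators of the stabilizer therefore reach all of it.\<close>

definition transporter :: "'a set \<Rightarrow> 'c \<Rightarrow> 'c \<Rightarrow> 'a set" where
  "transporter H x y = {g \<in> H. \<phi> g x = y}"

lemma subgroup_transporter:
  assumes "subgroup H G" "x \<in> E"
  shows "subgroup (transporter H x x) G"
proof -
  interpret H: subgroup H G by fact
  show ?thesis
    using assms(2) H.subset H.m_closed H.m_inv_closed
    by unfold_locales
      (auto simp: transporter_def act_mult act_one H.mem_carrier, metis H.mem_carrier act_inv)
qed

end

section \<open>Recursive presentations relative to a subgroup with finitely many orbits\<close>

locale cofinite_subgroup = graph_action +
  fixes \<Gamma> F \<rho> \<gamma>
  assumes subgroup_\<Gamma>: "subgroup \<Gamma> G"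
    and F: "finite F" "F \<subseteq> E"
    and \<rho>: "\<And>x. x \<in> E \<Longrightarrow> \<rho> x \<in> F"
    and \<gamma>: "\<And>x. x \<in> E \<Longrightarrow> \<gamma> x \<in> \<Gamma>" "\<And>x. x \<in> E \<Longrightarrow> \<phi> (\<gamma> x) (\<rho> x) = x"
    and finite_adjacent: "\<And>x. x \<in> F \<Longrightarrow> finite (R `` {x})"
    and finite_stabilizer: "\<And>x. x \<in> F \<Longrightarrow> finite (transporter \<Gamma> x x)"
    and nonempty: "E \<noteq> {}"
begin

lemma F_in_E: "x \<in> F \<Longrightarrow> x \<in> E"
  using F by blast

lemma \<gamma>_carrier: "x \<in> E \<Longrightarrow> \<gamma> x \<in> carrier G"
  using \<gamma> subgroup.subset[OF subgroup_\<Gamma>] by blast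

text \<open>The word is a list of indices rather than of group elements, so that the same
  \<open>e\<close> can be evaluated with the generators of two different overgroups.\<close>

definition loop_word :: "('c \<Rightarrow> 'c \<Rightarrow> nat \<Rightarrow> 'a) \<Rightarrow> 'c \<Rightarrow> nat list \<Rightarrow> 'a" where
  "loop_word c x e = foldr (\<otimes>) (map (c x x) e) \<one>"

text \<open>
  \<open>None\<close> in \<open>\<delta>\<close> records that no element of \<open>H\<close> moves \<open>x\<close> to \<open>y\<close>; in that case \<open>c x y\<close> is junk. As \<open>R\<close> is
  reflexive, this is recorded even at a vertex without neighbours.
\<close>

definition presentation ::
  "'a set \<Rightarrow> nat \<Rightarrow> ('c \<Rightarrow> 'c \<Rightarrow> nat \<Rightarrow> 'a) \<Rightarrow> ('c \<times> 'c \<times> nat \<times> 'c \<Rightarrow> ('c \<times> nat list) option) \<Rightarrow> bool"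
where
  "presentation H m c \<delta> \<longleftrightarrow>
    (\<forall>x\<in>F. \<forall>y\<in>F. transporter H x y \<noteq> {} \<longrightarrow> (\<forall>j<m. c x y j \<in> transporter H x y)) \<and>
    (\<forall>x\<in>F. \<forall>y\<in>F. \<forall>g\<in>transporter H x y.
       \<exists>e. set e \<subseteq> {..<m} \<and> g = c x y 0 \<otimes> loop_word c x e) \<and>
    (\<forall>x\<in>F. \<forall>y\<in>F. \<forall>j<m. \<forall>z\<in>R `` {x}.
       if transporter H x y = {} then \<delta> (x, y, j, z) = None
       else \<exists>e. set e \<subseteq> {..<m} \<and> \<delta> (x, y, j, z) = Some (\<phi> (c x y j) z, e) \<and>
         inv (\<gamma> (\<phi> (c x y j) z)) \<otimes> c x y j \<otimes> \<gamma> z =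
           c (\<rho> z) (\<rho> (\<phi> (c x y j) z)) 0 \<otimes> loop_word c (\<rho> z) e)"

lemma loop_word_closed:
  assumes "presentation H m c \<delta>" "subgroup H G" "x \<in> F" "set e \<subseteq> {..<m}"
  shows "loop_word c x e \<in> transporter H x x"
proof -
  interpret S: subgroup "transporter H x x" G
    using assms F_in_E by (intro subgroup_transporter) auto
  have "c x x j \<in> transporter H x x" if "j < m" for j
    using assms that S.one_closed unfolding presentation_def by blast
  then show ?thesis
    using assms(4) unfolding loop_word_def by (induction e) auto
qed

text \<open>With \<open>\<delta>\<close> in common, induction on \<open>k\<close> shows that
  \<open>c1 x y j\<close> and \<open>c2 x y j\<close> agree on the ball of radius \<open>k\<close>
  about \<open>x\<close>, for all \<open>x\<close>, \<open>y\<close>, \<open>j\<close>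
  simultaneously. Connectedness and faithfulness turn agreement on all balls into equality.
  Exchanging the groups gives the reverse inclusion.\<close>

lemma presentation_subset:
  assumes H1: "presentation H1 m c1 \<delta>" "subgroup H1 G" "\<Gamma> \<subseteq> H1"
    and H2: "presentation H2 m c2 \<delta>" "subgroup H2 G" "\<Gamma> \<subseteq> H2"
    and m: "0 < m"
  shows "H1 \<subseteq> H2"
proof -
  interpret H1: subgroup H1 G by fact
  interpret H2: subgroup H2 G by fact
  have c1: "c1 x y j \<in> transporter H1 x y" if "transporter H1 x y \<noteq> {}" "x \<in> F" "y \<in> F" "j < m" for x y j
    using H1(1) that unfolding presentation_def by blast
  have c2: "c2 x y j \<in> transporter H2 x y" if "transporter H2 x y \<noteq> {}" "x \<in> F" "y \<in> F" "j < m" for x y j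
    using H2(1) that unfolding presentation_def by blast
  have step1: "if transporter H1 x y = {} then \<delta> (x, y, j, z) = None
       else \<exists>e. set e \<subseteq> {..<m} \<and> \<delta> (x, y, j, z) = Some (\<phi> (c1 x y j) z, e) \<and>
         inv (\<gamma> (\<phi> (c1 x y j) z)) \<otimes> c1 x y j \<otimes> \<gamma> z =
           c1 (\<rho> z) (\<rho> (\<phi> (c1 x y j) z)) 0 \<otimes> loop_word c1 (\<rho> z) e"
    if "x \<in> F" "y \<in> F" "j < m" "(x, z) \<in> R" for x y j z
    using H1(1) that unfolding presentation_def by blast
  have step2: "if transporter H2 x y = {} then \<delta> (x, y, j, z) = None
       else \<exists>e. set e \<subseteq> {..<m} \<and> \<delta> (x, y, j, z) = Some (\<phi> (c2 x y j) z, e) \<and>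
         inv (\<gamma> (\<phi> (c2 x y j) z)) \<otimes> c2 x y j \<otimes> \<gamma> z =
           c2 (\<rho> z) (\<rho> (\<phi> (c2 x y j) z)) 0 \<otimes> loop_word c2 (\<rho> z) e"
    if "x \<in> F" "y \<in> F" "j < m" "(x, z) \<in> R" for x y j z
    using H2(1) that unfolding presentation_def by blast
  have present: "transporter H1 x y = {} \<longleftrightarrow> transporter H2 x y = {}" if "x \<in> F" "y \<in> F" for x y
    using step1[OF that m adjacent_refl] step2[OF that m adjacent_refl] F_in_E[OF that(1)]
    by (auto split: if_splits)
  have loop_nonempty: "transporter H1 x x \<noteq> {}" if "x \<in> F" for x
    using act_one[OF F_in_E[OF that]] H1.one_closed unfolding transporter_def by blast
  \<comment> \<open>Loop generators fix the centre \<open>x\<close> and preserve distances, so every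
    partial product keeps \<open>v\<close> in the ball of radius \<open>k\<close> about
    \<open>x\<close>, where the generators agree.\<close>
  have word_agree: "\<phi> (c1 x y 0 \<otimes> loop_word c1 x e) v = \<phi> (c2 x y 0 \<otimes> loop_word c2 x e) v"
    if agree: "\<And>x y j v. \<lbrakk>x \<in> F; y \<in> F; j < m; transporter H1 x y \<noteq> {}; (x, v) \<in> R ^^ k\<rbrakk>
        \<Longrightarrow> \<phi> (c1 x y j) v = \<phi> (c2 x y j) v"
      and x: "x \<in> F" and y: "y \<in> F" and e: "set e \<subseteq> {..<m}"
      and v: "(x, v) \<in> R ^^ k" and ne: "transporter H1 x y \<noteq> {}" for k x y e v
  proof -
    have vE: "v \<in> E"
      using v relpow_carrier F_in_E x by blast
    have l1: "loop_word c1 x e \<in> transporter H1 x x" if "set e \<subseteq> {..<m}" for e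
      using loop_word_closed[OF H1(1,2) x that] .
    have l2: "loop_word c2 x e \<in> transporter H2 x x" if "set e \<subseteq> {..<m}" for e
      using loop_word_closed[OF H2(1,2) x that] .
    have near: "(x, \<phi> (loop_word c1 x e) v) \<in> R ^^ k" if "set e \<subseteq> {..<m}" for e
      using relpow_invariant[OF _ v, of "loop_word c1 x e"] l1[OF that] H1.mem_carrier
      by (simp add: transporter_def)
    have "\<phi> (loop_word c1 x e) v = \<phi> (loop_word c2 x e) v"
      using e
    proof (induction e)
      case Nil
      then show ?case by (simp add: loop_word_def)
    next
      case (Cons j e)
      then have j: "j < m" and e: "set e \<subseteq> {..<m}"
        by auto
      have "\<phi> (loop_word ci x (j # e)) v = \<phi> (ci x x j) (\<phi> (loop_word ci x e) v)"
        if "ci x x j \<in> carrier G" "loop_word ci x e \<in> carrier G" for ci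
        using that vE act_mult by (simp add: loop_word_def)
      moreover have "c1 x x j \<in> carrier G" "loop_word c1 x e \<in> carrier G"
        using c1[OF loop_nonempty x x j] l1[OF e] x H1.mem_carrier by (auto simp: transporter_def)
      moreover have "c2 x x j \<in> carrier G" "loop_word c2 x e \<in> carrier G"
        using c2[OF _ x x j] loop_nonempty[OF x] present[OF x x] l2[OF e] H2.mem_carrier
        unfolding transporter_def by blast+
      ultimately show ?case
        using Cons.IH[OF e] agree[OF x x j loop_nonempty[OF x] near[OF e]] by simp
    qed
    moreover have "c1 x y 0 \<in> carrier G" "loop_word c1 x e \<in> carrier G"
      using c1[OF ne x y m] l1[OF e] H1.mem_carrier by (auto simp: transporter_def)
    moreover have "c2 x y 0 \<in> carrier G" "loop_word c2 x e \<in> carrier G"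
      using c2[OF _ x y m] ne present[OF x y] l2[OF e] H2.mem_carrier
      unfolding transporter_def by blast+
    ultimately show ?thesis
      using agree[OF x y m ne near[OF e]] vE by (simp add: act_mult)
  qed
  have agree: "\<phi> (c1 x y j) v = \<phi> (c2 x y j) v"
    if "x \<in> F" "y \<in> F" "j < m" "transporter H1 x y \<noteq> {}" "(x, v) \<in> R ^^ k" for k x y j v
    using that
  proof (induction k arbitrary: x y j v)
    case 0
    have "c1 x y j \<in> transporter H1 x y" "c2 x y j \<in> transporter H2 x y"
      using 0 c1 c2 present by auto
    with 0 show ?case
      by (simp add: transporter_def)
  next
    case (Suc k)
    then obtain z where z: "(x, z) \<in> R" "(z, v) \<in> R ^^ k"
      by (meson relpow_Suc_E2)
    then have E: "x \<in> E" "z \<in> E" "v \<in> E"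
      using adjacent_carrier relpow_carrier by blast+
    define w where "w = \<phi> (c1 x y j) z"
    have tr: "transporter H2 x y \<noteq> {}"
      using Suc.prems present by auto
    obtain e where e: "set e \<subseteq> {..<m}" "\<delta> (x, y, j, z) = Some (w, e)"
      "inv (\<gamma> w) \<otimes> c1 x y j \<otimes> \<gamma> z = c1 (\<rho> z) (\<rho> w) 0 \<otimes> loop_word c1 (\<rho> z) e"
      using step1[OF Suc.prems(1-3) z(1)] Suc.prems(4) unfolding w_def by auto
    \<comment> \<open>The shared entry of \<open>\<delta>\<close> forces the same image
      \<open>w\<close> of \<open>z\<close> and the same word \<open>e\<close> for the section in
      both groups.\<close>
    have e2: "\<phi> (c2 x y j) z = w"
      "inv (\<gamma> w) \<otimes> c2 x y j \<otimes> \<gamma> z = c2 (\<rho> z) (\<rho> w) 0 \<otimes> loop_word c2 (\<rho> z) e"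
      using step2[OF Suc.prems(1-3) z(1)] tr e(2) by auto
    have cH: "c1 x y j \<in> H1" "c2 x y j \<in> H2"
      using c1[OF Suc.prems(4,1,2,3)] c2[OF tr Suc.prems(1,2,3)] by (auto simp: transporter_def)
    then have cc: "c1 x y j \<in> carrier G" "c2 x y j \<in> carrier G"
      by (auto simp: H1.mem_carrier H2.mem_carrier)
    have wE: "w \<in> E"
      using act_closed cc E by (simp add: w_def)
    have g: "\<gamma> w \<in> carrier G" "\<gamma> z \<in> carrier G" "\<gamma> w \<in> H1" "\<gamma> z \<in> H1"
      using \<gamma>_carrier \<gamma>(1) wE E H1(3) by auto
    \<comment> \<open>The vertex \<open>v\<close> is at distance at most \<open>k\<close> from the
      neighbour \<open>z\<close>. Pulling back by \<open>\<gamma> z\<close> brings it that close to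
      \<open>\<rho> z\<close>, where the induction hypothesis applies to the word of the
      section.\<close>
    have recursion: "\<phi> g v = \<phi> (\<gamma> w) (\<phi> (inv (\<gamma> w) \<otimes> g \<otimes> \<gamma> z) (\<phi> (inv (\<gamma> z)) v))"
      if "g \<in> carrier G" for g
      using that g E by (simp add: act_mult act_closed act_inv')
    have "\<phi> (inv (\<gamma> w) \<otimes> c1 x y j \<otimes> \<gamma> z) (\<rho> z) = \<rho> w"
      using cc g E wE \<gamma>(2) \<rho> F_in_E act_inv[of "\<gamma> w" "\<rho> w"]
      by (simp add: act_mult act_closed flip: w_def)
    moreover have "inv (\<gamma> w) \<otimes> c1 x y j \<otimes> \<gamma> z \<in> H1"
      using cH g by simp
    ultimately have ne: "transporter H1 (\<rho> z) (\<rho> w) \<noteq> {}"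
      by (auto simp: transporter_def)
    have "(\<rho> z, \<phi> (inv (\<gamma> z)) v) \<in> R ^^ k"
      using relpow_invariant[OF _ z(2), of "inv (\<gamma> z)"] g E \<gamma>(2)[OF E(2)] \<rho> F_in_E
        act_inv[of "\<gamma> z" "\<rho> z"] by simp
    then have "\<phi> (c1 (\<rho> z) (\<rho> w) 0 \<otimes> loop_word c1 (\<rho> z) e) (\<phi> (inv (\<gamma> z)) v) =
        \<phi> (c2 (\<rho> z) (\<rho> w) 0 \<otimes> loop_word c2 (\<rho> z) e) (\<phi> (inv (\<gamma> z)) v)"
      using Suc.IH e(1) ne \<rho> E wE by (intro word_agree[where k = k]) auto
    then show ?case
      using recursion[OF cc(1)] recursion[OF cc(2)] e(3) e2(2) by simp
  qed
  show ?thesis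
  proof
    fix g assume g: "g \<in> H1"
    obtain x where x: "x \<in> F"
      using nonempty \<rho> by blast
    define w where "w = \<phi> g x"
    have wE: "w \<in> E"
      using g x act_closed F_in_E H1.mem_carrier by (simp add: w_def)
    \<comment> \<open>Correcting by an element of \<open>\<Gamma>\<close>, which both groups
      contain, brings the image of \<open>x\<close> back into \<open>F\<close>. The word for
      \<open>a\<close> in \<open>H1\<close> is then evaluated in \<open>H2\<close> as
      \<open>b\<close>.\<close>
    define a where "a = inv (\<gamma> w) \<otimes> g"
    have \<gamma>w: "\<gamma> w \<in> carrier G" "\<gamma> w \<in> H1" "\<gamma> w \<in> H2"
      using \<gamma>_carrier \<gamma>(1) wE H1(3) H2(3) by auto
    have "\<phi> a x = \<rho> w"
      using act_inv[of "\<gamma> w" "\<rho> w"] \<gamma>w \<gamma>(2)[OF wE] \<rho>[OF wE] x F_in_E g H1.mem_carrier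
      by (simp add: a_def act_mult flip: w_def)
    then have a: "a \<in> transporter H1 x (\<rho> w)"
      using \<gamma>w g by (simp add: transporter_def a_def)
    then obtain e where e: "set e \<subseteq> {..<m}" "a = c1 x (\<rho> w) 0 \<otimes> loop_word c1 x e"
      using H1(1) x \<rho>[OF wE] unfolding presentation_def by blast
    define b where "b = c2 x (\<rho> w) 0 \<otimes> loop_word c2 x e"
    have b: "b \<in> H2"
      using loop_word_closed[OF H2(1,2) x e(1)] c2[OF _ x \<rho>[OF wE] m] a present[OF x \<rho>[OF wE]]
      by (auto simp: b_def transporter_def)
    have "\<phi> a v = \<phi> b v" if v: "v \<in> E" for v
    proof -
      obtain k where "(x, v) \<in> R ^^ k"
        using adjacent_connected[OF F_in_E[OF x] v] rtrancl_imp_relpow by blast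
      then show ?thesis
        unfolding e(2) b_def using agree x \<rho>[OF wE] e(1) a by (intro word_agree) auto
    qed
    moreover have "a \<in> H1"
      using a by (simp add: transporter_def)
    ultimately have "a = b"
      using b H1.mem_carrier H2.mem_carrier by (intro act_eqI) auto
    moreover have "g = \<gamma> w \<otimes> a"
      using \<gamma>w g H1.mem_carrier by (simp add: a_def flip: m_assoc)
    ultimately show "g \<in> H2"
      using b \<gamma>w by simp
  qed
qed

text \<open>Short product systems of the stabilizers serve as loop generators, so only the
  \<open>2 ^ (2 * t)\<close> increasing words are needed. Confining \<open>\<delta>\<close> to a
  finite set of extensional functions prepares the count; \<open>1 \<le> t\<close> makes index 0
  available.\<close>

lemma presentation_exists:
  assumes H: "subgroup H G" "\<Gamma> \<subseteq> H" and t: "1 \<le> t"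
    and small: "\<And>x. x \<in> F \<Longrightarrow> finite (transporter H x x) \<and> card (transporter H x x) \<le> 2 ^ t"
  obtains c \<delta> where "presentation H (2 * t) c \<delta>"
    "\<delta> \<in> F \<times> F \<times> {..<2 * t} \<times> R `` F \<rightarrow>\<^sub>E
      insert None (Some ` (R `` F \<times> set (subseqs [0..<2 * t])))"
proof -
  interpret H: subgroup H G by fact
  define m where "m = 2 * t"
  have "\<exists>hs. length hs = m \<and> set hs \<subseteq> transporter H x x \<and>
      (\<forall>g\<in>transporter H x x. \<exists>ws. subseq ws hs \<and> g = foldr (\<otimes>) ws \<one>)" if x: "x \<in> F" for x
  proof -
    interpret S: subgroup "transporter H x x" G
      using H x F_in_E by (intro subgroup_transporter) auto
    interpret S': group "G\<lparr>carrier := transporter H x x\<rparr>"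
      using S.subgroup_axioms by (rule subgroup_imp_group)
    have "finite (carrier (G\<lparr>carrier := transporter H x x\<rparr>))"
      "order (G\<lparr>carrier := transporter H x x\<rparr>) \<le> 2 ^ t"
      using small[OF x] by (auto simp: order_def)
    then show ?thesis
    proof (rule S'.short_product_system)
      fix hs
      assume "length hs = 2 * t" "set hs \<subseteq> carrier (G\<lparr>carrier := transporter H x x\<rparr>)"
        and "\<And>g. g \<in> carrier (G\<lparr>carrier := transporter H x x\<rparr>) \<Longrightarrow> \<exists>ws. subseq ws hs \<and>
          g = foldr (\<otimes>\<^bsub>G\<lparr>carrier := transporter H x x\<rparr>\<^esub>) ws \<one>\<^bsub>G\<lparr>carrier := transporter H x x\<rparr>\<^esub>"
      then show ?thesis
        by (intro exI[of _ hs]) (simp add: m_def)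
    qed
  qed
  then obtain hs where hs: "\<And>x. x \<in> F \<Longrightarrow> length (hs x) = m"
    "\<And>x. x \<in> F \<Longrightarrow> set (hs x) \<subseteq> transporter H x x"
    "\<And>x g. x \<in> F \<Longrightarrow> g \<in> transporter H x x \<Longrightarrow> \<exists>ws. subseq ws (hs x) \<and> g = foldr (\<otimes>) ws \<one>"
    by metis
  \<comment> \<open>For \<open>x \<noteq> y\<close> all indices name the same arbitrary arrow; one
    arrow suffices since the loop words at \<open>x\<close> supply the rest of its coset.\<close>
  define c where "c x y j = (if x = y then hs x ! j else SOME g. g \<in> transporter H x y)" for x y j
  have c: "c x y j \<in> transporter H x y"
    if "x \<in> F" "transporter H x y \<noteq> {}" "j < m" for x y j
    using that hs(1,2)[OF that(1)] some_in_eq[of "transporter H x y"]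
    by (auto simp: c_def) (metis nth_mem subsetD)
  have loop: "\<exists>e. subseq e [0..<m] \<and> g = loop_word c x e"
    if x: "x \<in> F" and g: "g \<in> transporter H x x" for x g
  proof -
    obtain ws where ws: "subseq ws (hs x)" "g = foldr (\<otimes>) ws \<one>"
      using hs(3)[OF x g] by blast
    have "hs x = map (c x x) [0..<m]"
      using hs(1)[OF x] by (intro nth_equalityI) (auto simp: c_def)
    then obtain e where "subseq e [0..<m]" "ws = map (c x x) e"
      using ws(1) by (metis subseq_mapE)
    then show ?thesis
      using ws(2) unfolding loop_word_def by blast
  qed
  have arrow: "\<exists>e. subseq e [0..<m] \<and> g = c x y 0 \<otimes> loop_word c x e"
    if x: "x \<in> F" and g: "g \<in> transporter H x y" for x y g
  proof -
    have c0: "c x y 0 \<in> transporter H x y"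
      using c[OF x, of y 0] g t by (auto simp: m_def)
    then have cg: "c x y 0 \<in> H" "g \<in> H" "c x y 0 \<in> carrier G" "g \<in> carrier G"
      using g by (auto simp: transporter_def)
    have "inv (c x y 0) \<otimes> g \<in> transporter H x x"
      using c0 g cg x F_in_E act_inv[OF cg(3), of x] by (auto simp: transporter_def act_mult)
    from loop[OF x this] obtain e where "subseq e [0..<m]" "inv (c x y 0) \<otimes> g = loop_word c x e"
      by blast
    moreover have "g = c x y 0 \<otimes> (inv (c x y 0) \<otimes> g)"
      using cg by (simp flip: m_assoc)
    ultimately show ?thesis
      by metis
  qed
  have letters: "set e \<subseteq> {..<m}" if "subseq e [0..<m]" for e
    using subseq_set_subset[OF that] by auto
  define \<sigma> where "\<sigma> x y j z = inv (\<gamma> (\<phi> (c x y j) z)) \<otimes> c x y j \<otimes> \<gamma> z" for x y j z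
  define \<epsilon> where "\<epsilon> x y j z = (SOME e. subseq e [0..<m] \<and>
    \<sigma> x y j z = c (\<rho> z) (\<rho> (\<phi> (c x y j) z)) 0 \<otimes> loop_word c (\<rho> z) e)" for x y j z
  \<comment> \<open>The elements \<open>\<gamma> z\<close> and \<open>\<gamma> w\<close> lie in
    \<open>H\<close>, so the section lies in \<open>H\<close> and moves \<open>\<rho> z\<close> to
    \<open>\<rho> w\<close>. As \<open>w\<close> is adjacent or equal to \<open>y\<close>, the
    recorded images stay in a finite set.\<close>
  have near: "\<phi> (c x y j) z \<in> R `` {y} \<and> subseq (\<epsilon> x y j z) [0..<m] \<and>
      \<sigma> x y j z = c (\<rho> z) (\<rho> (\<phi> (c x y j) z)) 0 \<otimes> loop_word c (\<rho> z) (\<epsilon> x y j z)"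
    if x: "x \<in> F" and "transporter H x y \<noteq> {}" and "j < m" and xz: "(x, z) \<in> R" for x y j z
  proof -
    define w where "w = \<phi> (c x y j) z"
    have cH: "c x y j \<in> H" "c x y j \<in> carrier G" "\<phi> (c x y j) x = y"
      using c that by (auto simp: transporter_def)
    have E: "z \<in> E" "w \<in> E"
      using xz adjacent_carrier act_closed cH by (auto simp: w_def)
    have g: "\<gamma> w \<in> carrier G" "\<gamma> z \<in> carrier G" "\<gamma> w \<in> H" "\<gamma> z \<in> H"
      using \<gamma>_carrier \<gamma>(1) E H(2) by auto
    have "\<phi> (\<sigma> x y j z) (\<rho> z) = \<rho> w"
      using cH g E \<gamma>(2) \<rho> F_in_E act_inv[of "\<gamma> w" "\<rho> w"]
      by (simp add: \<sigma>_def act_mult act_closed flip: w_def)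
    moreover have "\<sigma> x y j z \<in> H"
      using cH g by (simp add: \<sigma>_def flip: w_def)
    ultimately have "\<exists>e. subseq e [0..<m] \<and> \<sigma> x y j z = c (\<rho> z) (\<rho> w) 0 \<otimes> loop_word c (\<rho> z) e"
      using \<rho>[OF E(1)] by (intro arrow) (auto simp: transporter_def)
    then show ?thesis
      using someI_ex[of "\<lambda>e. subseq e [0..<m] \<and> \<sigma> x y j z = c (\<rho> z) (\<rho> w) 0 \<otimes> loop_word c (\<rho> z) e"]
        adjacent_invariant[OF cH(2) xz] cH(3) by (simp add: \<epsilon>_def w_def)
  qed
  \<comment> \<open>The domain is a full product. At triples whose \<open>z\<close> is not related
    to \<open>x\<close>, where \<open>presentation\<close> asks nothing, the entry is set to
    \<open>None\<close>.\<close>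
  define \<delta> where "\<delta> = (\<lambda>(x, y, j, z) \<in> F \<times> F \<times> {..<m} \<times> R `` F.
    if transporter H x y \<noteq> {} \<and> (x, z) \<in> R then Some (\<phi> (c x y j) z, \<epsilon> x y j z) else None)"
  have "presentation H m c \<delta>"
    unfolding presentation_def
  proof (intro conjI ballI allI impI)
    show "c x y j \<in> transporter H x y"
      if "x \<in> F" "y \<in> F" "transporter H x y \<noteq> {}" "j < m" for x y j
      using c that by blast
    show "\<exists>e. set e \<subseteq> {..<m} \<and> g = c x y 0 \<otimes> loop_word c x e"
      if "x \<in> F" "y \<in> F" "g \<in> transporter H x y" for x y g
      using arrow[OF that(1,3)] letters by blast
    show "if transporter H x y = {} then \<delta> (x, y, j, z) = None
       else \<exists>e. set e \<subseteq> {..<m} \<and> \<delta> (x, y, j, z) = Some (\<phi> (c x y j) z, e) \<and>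
         inv (\<gamma> (\<phi> (c x y j) z)) \<otimes> c x y j \<otimes> \<gamma> z =
           c (\<rho> z) (\<rho> (\<phi> (c x y j) z)) 0 \<otimes> loop_word c (\<rho> z) e"
      if "x \<in> F" "y \<in> F" "j < m" "z \<in> R `` {x}" for x y j z
    proof -
      have "(x, y, j, z) \<in> F \<times> F \<times> {..<m} \<times> R `` F" "(x, z) \<in> R"
        using that by auto
      then show ?thesis
        using near[of x y j z] that letters[of "\<epsilon> x y j z"] by (auto simp: \<delta>_def \<sigma>_def)
    qed
  qed
  moreover have "\<delta> \<in> F \<times> F \<times> {..<m} \<times> R `` F \<rightarrow>\<^sub>E
      insert None (Some ` (R `` F \<times> set (subseqs [0..<m])))"
  proof -
    have "(\<phi> (c x y j) z, \<epsilon> x y j z) \<in> R `` F \<times> set (subseqs [0..<m])"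
      if "x \<in> F" "y \<in> F" "j < m" "transporter H x y \<noteq> {}" "(x, z) \<in> R" for x y j z
      using near[of x y j z] that by auto
    then show ?thesis
      unfolding \<delta>_def restrict_PiE_iff by (simp del: in_set_subseqs)
  qed
  ultimately show ?thesis
    using that unfolding m_def by blast
qed

section \<open>Counting the overgroups of a given index\<close>

definition overgroups_of_index :: "nat \<Rightarrow> 'a set set" where
  "overgroups_of_index n =
    {H. subgroup H G \<and> \<Gamma> \<subseteq> H \<and> card (rcosets\<^bsub>G\<lparr>carrier := H\<rparr>\<^esub> \<Gamma>) = n}"

text \<open>The stabilizer in \<open>H\<close> meets \<open>\<Gamma>\<close> in the stabilizer in
  \<open>\<Gamma>\<close>, so its order grows at most by the index. An infinite coset space would
  have \<open>card\<close> 0, which \<open>0 < n\<close> excludes.\<close>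

lemma stabilizer_overgroup:
  assumes H: "H \<in> overgroups_of_index n" and n: "0 < n" and x: "x \<in> F"
  shows "finite (transporter H x x) \<and> card (transporter H x x) \<le> n * card (transporter \<Gamma> x x)"
proof -
  have "subgroup H G" "\<Gamma> \<subseteq> H" and card: "card (rcosets\<^bsub>G\<lparr>carrier := H\<rparr>\<^esub> \<Gamma>) = n"
    using H by (auto simp: overgroups_of_index_def)
  interpret H: group "G\<lparr>carrier := H\<rparr>"
    using \<open>subgroup H G\<close> by (rule subgroup_imp_group)
  have S: "subgroup (transporter H x x) (G\<lparr>carrier := H\<rparr>)"
    using subgroup_transporter[OF \<open>subgroup H G\<close> F_in_E[OF x]] \<open>subgroup H G\<close>
    by (intro subgroup_incl) (auto simp: transporter_def)
  have K: "subgroup \<Gamma> (G\<lparr>carrier := H\<rparr>)"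
    using \<open>\<Gamma> \<subseteq> H\<close> \<open>subgroup H G\<close> subgroup_\<Gamma> by (intro subgroup_incl)
  have "transporter H x x \<inter> \<Gamma> = transporter \<Gamma> x x"
    using \<open>\<Gamma> \<subseteq> H\<close> by (auto simp: transporter_def)
  then show ?thesis
    using H.card_le_index_times_card_Int[OF S K] finite_stabilizer[OF x] card n
    by (metis card.infinite less_numeral_extra(3))
qed

text \<open>Choosing a table \<open>\<delta>\<close> for each overgroup is injective by
  \<open>presentation_subset\<close>, used in both directions. The bound counts tables: the exponent
  is the size of the domain, and the base bounds the possible entries, \<open>None\<close>
  included.\<close>

lemma card_overgroups_of_index_le:
  assumes n: "0 < n" and t: "1 \<le> t" and small: "\<And>x. x \<in> F \<Longrightarrow> n * card (transporter \<Gamma> x x) \<le> 2 ^ t"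
  shows "finite (overgroups_of_index n) \<and>
    card (overgroups_of_index n) \<le>
      (1 + card (R `` F) * 2 ^ (2 * t)) ^ (card F * card F * (2 * t) * card (R `` F))"
proof -
  define W where "W = R `` F"
  define D where "D = F \<times> F \<times> {..<2 * t} \<times> W"
  define V where "V = insert None (Some ` (W \<times> set (subseqs [0..<2 * t])))"
  have "finite W"
    using F finite_adjacent unfolding W_def by (subst Image_eq_UN) auto
  then have fin: "finite D" "finite V"
    using F by (auto simp: D_def V_def)
  have "\<forall>H\<in>overgroups_of_index n. \<exists>\<delta>. \<delta> \<in> D \<rightarrow>\<^sub>E V \<and> (\<exists>c. presentation H (2 * t) c \<delta>)"
  proof
    fix H assume H: "H \<in> overgroups_of_index n"
    then have "subgroup H G" "\<Gamma> \<subseteq> H"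
      by (auto simp: overgroups_of_index_def)
    moreover have "finite (transporter H x x) \<and> card (transporter H x x) \<le> 2 ^ t" if "x \<in> F" for x
      using stabilizer_overgroup[OF H n that] small[OF that] by linarith
    ultimately show "\<exists>\<delta>. \<delta> \<in> D \<rightarrow>\<^sub>E V \<and> (\<exists>c. presentation H (2 * t) c \<delta>)"
      using presentation_exists[of H t] t unfolding D_def V_def W_def by metis
  qed
  then obtain \<Delta> where \<Delta>: "\<And>H. H \<in> overgroups_of_index n \<Longrightarrow> \<Delta> H \<in> D \<rightarrow>\<^sub>E V"
    "\<And>H. H \<in> overgroups_of_index n \<Longrightarrow> \<exists>c. presentation H (2 * t) c (\<Delta> H)"
    by metis
  have inj: "inj_on \<Delta> (overgroups_of_index n)"
  proof
    fix H1 H2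
    assume H: "H1 \<in> overgroups_of_index n" "H2 \<in> overgroups_of_index n" "\<Delta> H1 = \<Delta> H2"
    then have "subgroup H1 G" "\<Gamma> \<subseteq> H1" "subgroup H2 G" "\<Gamma> \<subseteq> H2"
      by (auto simp: overgroups_of_index_def)
    moreover obtain c1 c2 where "presentation H1 (2 * t) c1 (\<Delta> H1)" "presentation H2 (2 * t) c2 (\<Delta> H1)"
      using \<Delta>(2) H by metis
    ultimately show "H1 = H2"
      using presentation_subset[of H1 "2 * t" c1 "\<Delta> H1" H2 c2]
        presentation_subset[of H2 "2 * t" c2 "\<Delta> H1" H1 c1] t by auto
  qed
  have sub: "\<Delta> ` overgroups_of_index n \<subseteq> D \<rightarrow>\<^sub>E V"
    using \<Delta>(1) by blast
  have finPi: "finite (D \<rightarrow>\<^sub>E V)"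
    using fin by (intro finite_PiE) auto
  have "card V \<le> 1 + card W * 2 ^ (2 * t)"
  proof -
    have "card V \<le> 1 + card (W \<times> set (subseqs [0..<2 * t]))"
      unfolding V_def using card_image_le[of "W \<times> set (subseqs [0..<2 * t])" Some] \<open>finite W\<close>
      by (subst card_insert_disjoint) auto
    also have "card (W \<times> set (subseqs [0..<2 * t])) \<le> card W * 2 ^ (2 * t)"
      using card_length[of "subseqs [0..<2 * t]"] by (simp add: card_cartesian_product length_subseqs)
    finally show ?thesis by simp
  qed
  moreover have "card (D \<rightarrow>\<^sub>E V) = card V ^ card D"
    using fin by (simp add: card_PiE)
  moreover have "card D = card F * card F * (2 * t) * card W"
    by (simp add: D_def card_cartesian_product)
  ultimately have "card (D \<rightarrow>\<^sub>E V) \<le> (1 + card W * 2 ^ (2 * t)) ^ (card F * card F * (2 * t) * card W)"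
    by (simp add: power_mono)
  then show ?thesis
    using finite_subset[OF sub finPi] finite_image_iff[OF inj] card_mono[OF finPi sub]
      card_image[OF inj] unfolding W_def by simp
qed

end

section \<open>The growth estimate\<close>

lemma ex_le_power2: "\<exists>a. (k::nat) \<le> 2 ^ a"
  by (meson less_exp order.strict_implies_order)

text \<open>Taking \<open>t\<close> of order \<open>ln n\<close> gives a bound of the form
  \<open>2 ^ (B * t\<^sup>2)\<close>, quadratic in \<open>ln n\<close> in the exponent. The claimed
  bound is cubic there, so \<open>L\<^sup>2 \<le> 1 + L ^ 3\<close> suffices; the 1 goes into
  \<open>C0\<close>, which alone remains on the right at \<open>n = 1\<close>.\<close>

lemma (in cofinite_subgroup) card_overgroups_growth:
  "\<exists>C\<^sub>0>0. \<exists>C\<^sub>1>0. \<forall>n::nat. n \<ge> 1 \<longrightarrow> finite (overgroups_of_index n) \<and>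
     real (card (overgroups_of_index n)) \<le> C\<^sub>0 * real n powr (C\<^sub>1 * (ln (real n))\<^sup>2)"
proof -
  define w where "w = card (R `` F)"
  define k where "k = card F * card F"
  obtain a where a: "1 + w \<le> 2 ^ a"
    using ex_le_power2 by blast
  obtain t0 where "Max (insert 0 ((\<lambda>x. card (transporter \<Gamma> x x)) ` F)) \<le> 2 ^ t0"
    using ex_le_power2 by blast
  then have t0: "card (transporter \<Gamma> x x) \<le> 2 ^ t0" if "x \<in> F" for x
    using that F by auto
  \<comment> \<open>Here \<open>B\<close> collects the base, at most
    \<open>2 ^ ((a + 2) * t)\<close>, and the exponent \<open>k * (2 * t) * w\<close>.
    \<open>A\<close> is chosen so that \<open>t\<close> is at most \<open>A + L / ln 2\<close>, and
    \<open>q\<close> is the coefficient of \<open>L\<^sup>2\<close> after squaring this.\<close>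
  define B where "B = (a + 2) * (2 * k * w)"
  define A where "A = real t0 + 2"
  define q where "q = 2 / (ln (2::real))\<^sup>2"
  have q: "0 \<le> q"
    by (simp add: q_def)
  define C0 where "C0 = 2 powr (B * (2 * A\<^sup>2 + q))"
  \<comment> \<open>The factor \<open>ln 2\<close> changes the base from 2 to e; the summand 1 gives
    positivity without a lower bound on \<open>B\<close>.\<close>
  define C1 where "C1 = ln 2 * (B * q) + 1"
  have "finite (overgroups_of_index n) \<and>
     real (card (overgroups_of_index n)) \<le> C0 * real n powr (C1 * (ln (real n))\<^sup>2)" if n: "n \<ge> 1" for n
  proof -
    define L where "L = ln (real n)"
    have L: "0 \<le> L"
      using n by (simp add: L_def)
    define s where "s = nat \<lceil>log 2 (real n)\<rceil>"
    have "real n = 2 powr log 2 (real n)"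
      using n by simp
    also have "\<dots> \<le> 2 powr real s"
      unfolding s_def by (intro powr_mono) linarith+
    finally have ns: "n \<le> 2 ^ s"
      by (simp add: powr_realpow)
    have "0 \<le> log 2 (real n)"
      using n by simp
    then have s: "real s \<le> L / ln 2 + 1"
      unfolding s_def L_def log_def by linarith
    \<comment> \<open>The summand 1 ensures \<open>1 \<le> t\<close> even at \<open>n = 1\<close>;
      this also yields \<open>a + 2 * t \<le> (a + 2) * t\<close> below.\<close>
    define t where "t = t0 + s + 1"
    have t: "1 \<le> t" "real t \<le> A + L / ln 2"
      using s by (auto simp: t_def A_def)
    have small: "n * card (transporter \<Gamma> x x) \<le> 2 ^ t" if "x \<in> F" for x
    proof -
      have "n * card (transporter \<Gamma> x x) \<le> 2 ^ s * 2 ^ t0"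
        using ns t0[OF that] by (rule mult_le_mono)
      also have "\<dots> \<le> 2 ^ t"
        by (simp add: t_def power_add)
      finally show ?thesis .
    qed
    have "1 + w * 2 ^ (2 * t) \<le> (1 + w) * 2 ^ (2 * t)"
      by simp
    also have "\<dots> \<le> 2 ^ a * 2 ^ (2 * t)"
      using a by (rule mult_le_mono1)
    also have "\<dots> \<le> 2 ^ ((a + 2) * t)"
      unfolding power_add[symmetric] using t(1) by (intro power_increasing) (auto simp: algebra_simps)
    finally have "(1 + w * 2 ^ (2 * t)) ^ (k * (2 * t) * w) \<le> (2 ^ ((a + 2) * t)) ^ (k * (2 * t) * w)"
      by (intro power_mono) auto
    also have "\<dots> = 2 ^ (B * t\<^sup>2)"
      by (simp add: B_def power2_eq_square algebra_simps flip: power_mult)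
    finally have fin: "finite (overgroups_of_index n)"
      and le: "card (overgroups_of_index n) \<le> 2 ^ (B * t\<^sup>2)"
      using card_overgroups_of_index_le[OF _ t(1) small] n unfolding k_def w_def by force+
    have L3: "L\<^sup>2 \<le> 1 + L ^ 3"
    proof (cases "L \<le> 1")
      case True
      then have "L\<^sup>2 \<le> 1"
        using L by (simp add: power_le_one)
      with L show ?thesis
        by (simp add: add_increasing2)
    next
      case False
      then have "L\<^sup>2 \<le> L ^ 3"
        by (intro power_increasing) auto
      then show ?thesis
        by simp
    qed
    have "(real t)\<^sup>2 \<le> (A + L / ln 2)\<^sup>2"
      using t by (intro power_mono) auto
    also have "\<dots> \<le> 2 * A\<^sup>2 + 2 * (L / ln 2)\<^sup>2"
      using sum_squares_bound[of A "L / ln 2"] by (simp only: power2_sum)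
    also have "\<dots> = 2 * A\<^sup>2 + q * L\<^sup>2"
      by (simp add: power_divide q_def)
    also have "\<dots> \<le> 2 * A\<^sup>2 + q * (1 + L ^ 3)"
      using L3 q by (intro add_left_mono mult_left_mono)
    finally have "B * (real t)\<^sup>2 \<le> B * (2 * A\<^sup>2 + q * (1 + L ^ 3))"
      by (rule mult_left_mono) simp
    then have "real (B * t\<^sup>2) \<le> B * (2 * A\<^sup>2 + q) + B * q * L ^ 3"
      by (simp add: algebra_simps)
    then have "2 powr real (B * t\<^sup>2) \<le> 2 powr (B * (2 * A\<^sup>2 + q) + B * q * L ^ 3)"
      by (rule powr_mono) simp
    also have "\<dots> = C0 * exp ((C1 - 1) * L ^ 3)"
      unfolding C0_def C1_def powr_add by (simp add: powr_def mult_ac)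
    also have "\<dots> \<le> C0 * exp (C1 * L ^ 3)"
      using L by (intro mult_left_mono) (auto simp: C0_def mult_right_mono)
    also have "exp (C1 * L ^ 3) = real n powr (C1 * L\<^sup>2)"
      using n by (simp add: powr_def L_def power3_eq_cube power2_eq_square mult_ac)
    finally have "2 powr real (B * t\<^sup>2) \<le> C0 * real n powr (C1 * L\<^sup>2)" .
    moreover have "real (card (overgroups_of_index n)) \<le> 2 powr real (B * t\<^sup>2)"
      using le by (subst powr_realpow) (simp_all flip: of_nat_le_iff)
    ultimately show ?thesis
      using fin by (simp add: L_def)
  qed
  moreover have "0 < C0" "0 < C1"
    by (use q in \<open>auto simp: C0_def C1_def intro!: add_nonneg_pos\<close>)
  ultimately show ?thesis
    by blast
qed

section \<open>Automorphism groups of trees\<close>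

lemma faithful_action_Aut: "faithful_action (Aut T) (pverts T) (\<lambda>g. g)"
proof -
  have "(\<lambda>g. g) \<in> hom (Aut T) (BijGroup (pverts T))"
    by (auto simp: hom_def Aut_def BijGroup_def)
  then show ?thesis
    by (intro faithful_action.intro group_action.intro group_hom.intro group_hom_axioms.intro
        faithful_action_axioms.intro group_Aut group_BijGroup) simp_all
qed

text \<open>Adding the diagonal to the arcs provides reflexivity, and automorphisms preserve both
  pieces. Paths of the connected tree give the reflexive transitive closure.\<close>

lemma graph_action_Aut:
  assumes "locally_finite_tree T"
  shows "graph_action (Aut T) (pverts T) (\<lambda>g. g) (parcs T \<union> Id_on (pverts T))"
proof -
  interpret T: locally_finite_tree T by fact
  have arcs: "parcs T \<subseteq> pverts T \<times> pverts T"
    using T.arc_fst_in_verts T.arc_snd_in_verts by fastforce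
  interpret faithful_action "Aut T" "pverts T" "\<lambda>g. g"
    by (rule faithful_action_Aut)
  show ?thesis
  proof (intro graph_action.intro graph_action_axioms.intro)
    show "faithful_action (Aut T) (pverts T) (\<lambda>g. g)" "group (Aut T)"
      by (rule faithful_action_Aut group_Aut)+
    show "parcs T \<union> Id_on (pverts T) \<subseteq> pverts T \<times> pverts T"
      using arcs by auto
    show "(x, y) \<in> (parcs T \<union> Id_on (pverts T))\<^sup>*" if "x \<in> pverts T" "y \<in> pverts T" for x y
    proof -
      have "x \<rightarrow>\<^sup>*\<^bsub>with_proj T\<^esub> y"
        using T.tree_connected that by (auto simp: strongly_connected_def)
      then have "(x, y) \<in> rtrancl_on (pverts T) (parcs T)"
        by (simp add: reachable_def)
      then show ?thesis
        by (induction rule: rtrancl_on.induct) (auto intro: rtrancl_into_rtrancl)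
    qed
    show "(g x, g y) \<in> parcs T \<union> Id_on (pverts T)"
      if "g \<in> carrier (Aut T)" "(x, y) \<in> parcs T \<union> Id_on (pverts T)" for g x y
      using that arcs element_image[OF that(1)] by (auto simp: Aut_def)
  qed auto
qed

theorem theorem0p1:
  fixes T :: "'a pair_pre_digraph" and \<Gamma> :: "('a \<Rightarrow> 'a) set"
  assumes "locally_finite_tree T"
    and "cocompact_lattice T \<Gamma>"
  shows "\<exists>C\<^sub>0 > 0. \<exists>C\<^sub>1 > 0. \<forall>n::nat. n \<ge> 1 \<longrightarrow>
           finite (overgroups T \<Gamma> n) \<and>
           real (card (overgroups T \<Gamma> n)) \<le> C\<^sub>0 * real n powr (C\<^sub>1 * (ln (real n))\<^sup>2)"
proof -
  interpret T: locally_finite_tree T by fact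
  interpret graph_action "Aut T" "pverts T" "\<lambda>g. g" "parcs T \<union> Id_on (pverts T)"
    using assms(1) by (rule graph_action_Aut)
  have \<Gamma>: "subgroup \<Gamma> (Aut T)"
    using assms(2) by (simp add: cocompact_lattice_def lattice_subgroup_def discrete_subgroup_def)
  interpret \<Gamma>: subgroup \<Gamma> "Aut T" by (rule \<Gamma>)
  define Q where "Q = verts (quotient_graph T \<Gamma>)"
  define orb where "orb x = (\<lambda>g. g x) ` \<Gamma>" for x
  have Q: "Q = orb ` pverts T"
    by (simp add: Q_def quotient_graph_def orbits_def orbit_def orb_def image_def setcompr_eq_image)
  have finQ: "finite Q"
    using assms(2) by (simp add: cocompact_lattice_def Q_def)
  \<comment> \<open>This is the same choice of representatives as in \<open>covolume\<close>, so
    finite covolume controls the stabilizers at exactly these vertices, while discreteness by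
    definition speaks of a single vertex.\<close>
  define r where "r X = (SOME x. x \<in> X)" for X :: "'a set"
  have r: "r (orb x) \<in> orb x" for x
    unfolding r_def some_in_eq orb_def using \<Gamma>.one_closed by blast
  have orb_subset: "orb x \<subseteq> pverts T" if "x \<in> pverts T" for x
    using act_closed[OF \<Gamma>.mem_carrier that] by (auto simp: orb_def)
  have "\<exists>g\<in>\<Gamma>. g (r (orb x)) = x" if x: "x \<in> pverts T" for x
  proof -
    obtain g where g: "g \<in> \<Gamma>" "r (orb x) = g x"
      using r[of x] unfolding orb_def by (rule imageE)
    then show ?thesis
      using act_inv[OF \<Gamma>.mem_carrier x] \<Gamma>.m_inv_closed by metis
  qed
  then obtain \<gamma> where \<gamma>: "\<And>x. x \<in> pverts T \<Longrightarrow> \<gamma> x \<in> \<Gamma>"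
    "\<And>x. x \<in> pverts T \<Longrightarrow> \<gamma> x (r (orb x)) = x"
    by metis
  have stab: "vertex_stabilizer T \<Gamma> x = transporter \<Gamma> x x" for x
    by (simp add: stabilizer_def transporter_def)
  \<comment> \<open>An infinite stabilizer has \<open>card\<close> 0 and contributes \<open>1 / 0 = \<infinity>\<close> to the covolume.\<close>
  have finite_stab: "finite (transporter \<Gamma> (r X) (r X))" if X: "X \<in> Q" for X
  proof (rule ccontr)
    assume inf: "infinite (transporter \<Gamma> (r X) (r X))"
    define f :: "'a set \<Rightarrow> ennreal" where
      "f Y = 1 / of_nat (card (vertex_stabilizer T \<Gamma> (SOME x. x \<in> Y)))" for Y
    have "f X = \<infinity>"
      using inf unfolding f_def stab r_def by simp
    then have "(\<Sum>Y\<in>Q. f Y) = \<infinity>"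
      using member_le_sum[of X Q f] finQ X by (simp add: top_unique)
    then have "covolume T \<Gamma> = \<infinity>"
      using finQ by (simp add: covolume_def f_def flip: Q_def)
    then show False
      using assms(2) by (simp add: cocompact_lattice_def lattice_subgroup_def)
  qed
  interpret cofinite_subgroup "Aut T" "pverts T" "\<lambda>g. g" "parcs T \<union> Id_on (pverts T)"
    \<Gamma> "r ` Q" "\<lambda>x. r (orb x)" \<gamma>
  proof
    show "finite (r ` Q)" "r ` Q \<subseteq> pverts T"
      using finQ r orb_subset by (auto simp: Q)
    show "r (orb x) \<in> r ` Q" if "x \<in> pverts T" for x
      using that by (auto simp: Q)
    show "finite ((parcs T \<union> Id_on (pverts T)) `` {x})" if "x \<in> r ` Q" for x
    proof -
      have "(parcs T \<union> Id_on (pverts T)) `` {x} \<subseteq> insert x {w. (x, w) \<in> parcs T}"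
        by auto
      moreover have "finite {w. (x, w) \<in> parcs T}"
        using that r orb_subset by (intro T.finite_valence) (auto simp: Q)
      ultimately show ?thesis
        by (meson finite_insert finite_subset)
    qed
    show "pverts T \<noteq> {}"
      using T.tree_connected by (simp add: strongly_connected_def)
  qed (use \<Gamma> \<gamma> finite_stab in auto)
  have sub: "overgroups T \<Gamma> n \<subseteq> overgroups_of_index n" for n
    by (auto simp: overgroups_def overgroups_of_index_def)
  obtain C0 C1 where C: "0 < C0" "0 < C1"
    "\<And>n. n \<ge> 1 \<Longrightarrow> finite (overgroups_of_index n)"
    "\<And>n. n \<ge> 1 \<Longrightarrow> real (card (overgroups_of_index n)) \<le> C0 * real n powr (C1 * (ln (real n))\<^sup>2)"
    using card_overgroups_growth by blast
  have "finite (overgroups T \<Gamma> n) \<and>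
      real (card (overgroups T \<Gamma> n)) \<le> C0 * real n powr (C1 * (ln (real n))\<^sup>2)" if "n \<ge> 1" for n
  proof
    show "finite (overgroups T \<Gamma> n)"
      using finite_subset[OF sub C(3)[OF that]] .
    have "real (card (overgroups T \<Gamma> n)) \<le> real (card (overgroups_of_index n))"
      using card_mono[OF C(3)[OF that] sub] by simp
    with C(4)[OF that] show "real (card (overgroups T \<Gamma> n)) \<le> C0 * real n powr (C1 * (ln (real n))\<^sup>2)"
      by linarith
  qed
  with C(1,2) show ?thesis
    by blast
qed

end
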